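(* Let $P$ be an infinite production matrix and let $A_P$ be the ECO matrix induced by $P$. Then $A_P$ is a proper Riordan matrix if and only if $P$ is of the form $$P=\begin{pmatrix} \zeta_0 & \alpha_0 & 0 & 0 & 0 & \cdots\\ \zeta_1 & \alpha_1 & \alpha_0 & 0 & 0 & \cdots\\ \zeta_2 & \alpha_2 & \alpha_1 & \alpha_0 & 0 & \cdots\\ \zeta_3 & \alpha_3 & \alpha_2 & \alpha_1 & \alpha_0 & \cdots\\ \vdots & \vdots & \vdots & \vdots & \vdots & \ddots \end{pmatrix}$$ with $\alpha_0\neq 0$; that is, there are sequences $(\zeta_n)_{n\ge 0}$ and $(\alpha_n)_{n\geq 0}$ with $\alpha_0\ne 0$ such that the entries $p_{i,j}$ of $P$ satisfy $p_{i,0}=\zeta_i$ for $i\ge 0$, $p_{i,j}=\alpha_{i-j+1}$ for $1\leq j\leq i+1$, and $p_{i,j}=0$ for $j>i+1$. Moreover, in this case columns $0$ and $1$ of the matrix $P$ are, respectively, the $\zeta$-sequence and the $\alpha$-sequence of the Riordan matrix $A_P$.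
   Context: Rows and columns are indexed by nonnegative integers. A production matrix $P=(p_{i,j})$ is a square (possibly infinite) matrix of nonnegative integers, each of whose row sums is a finite positive integer; in particular each row has finitely many nonzero entries. Let $u^\top=(1,0,0,\ldots)$. The ECO matrix induced by $P$ is the matrix $A_P$ whose $n$-th row is $u^\top P^n$ for $n=0,1,2,\ldots$. A Riordan matrix is an infinite lower triangular matrix $A$ whose column $k$ ($k=0,1,2,\ldots$) has generating function $d(z)(zh(z))^k$, where $d(z),h(z)$ are formal power series with $d(0)\neq 0$; it is proper if in addition $h(0)\ne 0$. For a proper Riordan matrix $A=(d_{n,k})_{n,k\ge 0}$ there exist unique sequences $\alpha=(\alpha_0,\alpha_1,\ldots)$ with $\alpha_0\ne 0$ (the $\alpha$-sequence of $A$) and $\zeta=(\zeta_0,\zeta_1,\ldots)$ (the $\zeta$-sequence of $A$) such that for all $n,k\ge 0$ $$d_{n+1,0}=\zeta_0d_{n,0}+\zeta_1d_{n,1}+\zeta_2d_{n,2}+\cdots,\qquad d_{n+1,k+1}=\alpha_0d_{n,k}+\alpha_1d_{n,k+1}+\alpha_2d_{n,k+2}+\cdots .$$ *)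

theory Defs
  imports
    "HOL-Library.Groups_Big_Fun"
    "HOL-Computational_Algebra.Formal_Power_Series"
begin

text \<open>An infinite matrix is a function of its row and column index. \<^const>\<open>Sum_any\<close> sums over the
  support of a function and is \<open>0\<close> if the support is infinite; for the row-finite matrices
  considered here all supports are finite.\<close>

definition production_matrix :: "(nat \<Rightarrow> nat \<Rightarrow> nat) \<Rightarrow> bool" where
  "production_matrix P \<longleftrightarrow> (\<forall>i. finite {j. P i j \<noteq> 0} \<and> 0 < Sum_any (P i))"

definition mat_mult :: "(nat \<Rightarrow> nat \<Rightarrow> nat) \<Rightarrow> (nat \<Rightarrow> nat \<Rightarrow> nat) \<Rightarrow> nat \<Rightarrow> nat \<Rightarrow> nat" where
  "mat_mult A B i j = Sum_any (\<lambda>k. A i k * B k j)"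

primrec mat_pow :: "(nat \<Rightarrow> nat \<Rightarrow> nat) \<Rightarrow> nat \<Rightarrow> nat \<Rightarrow> nat \<Rightarrow> nat" where
  "mat_pow P 0 = (\<lambda>i j. if i = j then 1 else 0)"
| "mat_pow P (Suc n) = mat_mult (mat_pow P n) P"

definition unit_vec0 :: "nat \<Rightarrow> nat" where
  "unit_vec0 i = (if i = 0 then 1 else 0)"

definition eco_matrix :: "(nat \<Rightarrow> nat \<Rightarrow> nat) \<Rightarrow> nat \<Rightarrow> nat \<Rightarrow> nat" where
  "eco_matrix P n k = Sum_any (\<lambda>i. unit_vec0 i * mat_pow P n i k)"

definition riordan_with :: "'a::field fps \<Rightarrow> 'a fps \<Rightarrow> (nat \<Rightarrow> nat \<Rightarrow> 'a) \<Rightarrow> bool" where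
  "riordan_with d h A \<longleftrightarrow>
     (\<forall>n k. n < k \<longrightarrow> A n k = 0) \<and> fps_nth d 0 \<noteq> 0 \<and>
     (\<forall>k. Abs_fps (\<lambda>n. A n k) = d * (fps_X * h) ^ k)"

definition proper_riordan :: "(nat \<Rightarrow> nat \<Rightarrow> 'a::field) \<Rightarrow> bool" where
  "proper_riordan A \<longleftrightarrow> (\<exists>d h. riordan_with d h A \<and> fps_nth h 0 \<noteq> 0)"

text \<open>For lower triangular \<open>A\<close> the sums below have finite support.\<close>

definition is_zeta_sequence :: "(nat \<Rightarrow> nat \<Rightarrow> 'a::field) \<Rightarrow> (nat \<Rightarrow> 'a) \<Rightarrow> bool" where
  "is_zeta_sequence A \<zeta> \<longleftrightarrow> (\<forall>n. A (n + 1) 0 = Sum_any (\<lambda>j. \<zeta> j * A n j))"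

definition is_alpha_sequence :: "(nat \<Rightarrow> nat \<Rightarrow> 'a::field) \<Rightarrow> (nat \<Rightarrow> 'a) \<Rightarrow> bool" where
  "is_alpha_sequence A \<alpha> \<longleftrightarrow>
     \<alpha> 0 \<noteq> 0 \<and> (\<forall>n k. A (n + 1) (k + 1) = Sum_any (\<lambda>j. \<alpha> j * A n (k + j)))"

definition zeta_alpha_form :: "(nat \<Rightarrow> nat) \<Rightarrow> (nat \<Rightarrow> nat) \<Rightarrow> (nat \<Rightarrow> nat \<Rightarrow> nat) \<Rightarrow> bool" where
  "zeta_alpha_form \<zeta> \<alpha> P \<longleftrightarrow>
     (\<forall>i. P i 0 = \<zeta> i) \<and>
     (\<forall>i j. 1 \<le> j \<and> j \<le> i + 1 \<longrightarrow> P i j = \<alpha> (i + 1 - j)) \<and>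
     (\<forall>i j. j > i + 1 \<longrightarrow> P i j = 0)"

text \<open>The two predicates determine the sequences of a proper Riordan matrix, which justifies
  speaking of \<^emph>\<open>the\<close> \<open>\<zeta>\<close>-sequence and \<^emph>\<open>the\<close> \<open>\<alpha>\<close>-sequence.\<close>

lemma proper_riordan_lower_triangular:
  "proper_riordan A \<Longrightarrow> n < k \<Longrightarrow> A n k = 0"
  unfolding proper_riordan_def riordan_with_def by blast

lemma proper_riordan_diagonal:
  assumes "proper_riordan A"
  shows "A n n \<noteq> 0"
proof -
  obtain d h where d: "fps_nth d 0 \<noteq> 0" and h: "fps_nth h 0 \<noteq> 0"
    and col: "Abs_fps (\<lambda>m. A m n) = d * (fps_X * h) ^ n"
    using assms unfolding proper_riordan_def riordan_with_def by blast
  have "A n n = fps_nth (d * (fps_X * h) ^ n) n"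
    by (simp add: col [symmetric])
  also have "\<dots> = fps_nth (fps_X ^ n * (d * h ^ n)) n"
    by (simp add: power_mult_distrib mult_ac)
  also have "\<dots> = fps_nth d 0 * fps_nth h 0 ^ n"
    by (simp add: fps_X_power_mult_nth fps_nth_power_0)
  finally show ?thesis
    using d h by simp
qed

lemma proper_riordan_coeffs_unique:
  assumes A: "proper_riordan A"
    and eq: "\<And>n. Sum_any (\<lambda>j. a j * A n j) = Sum_any (\<lambda>j. b j * A n j)"
  shows "a = b"
proof
  fix n
  have fin: "Sum_any (\<lambda>j. c j * A n j) = (\<Sum>j<n. c j * A n j) + c n * A n n" for c n
  proof -
    have "Sum_any (\<lambda>j. c j * A n j) = (\<Sum>j\<in>{..n}. c j * A n j)"
      by (rule Sum_any.expand_superset)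
        (use proper_riordan_lower_triangular [OF A] in \<open>auto simp: not_less [symmetric]\<close>)
    then show ?thesis
      by (simp add: lessThan_Suc_atMost [symmetric])
  qed
  show "a n = b n"
  proof (induction n rule: less_induct)
    case (less n)
    then have "(\<Sum>j<n. a j * A n j) = (\<Sum>j<n. b j * A n j)"
      by simp
    with eq [of n] have "a n * A n n = b n * A n n"
      by (simp add: fin)
    then show ?case
      using proper_riordan_diagonal [OF A] by simp
  qed
qed

lemma zeta_sequence_unique:
  assumes "proper_riordan A" "is_zeta_sequence A \<zeta>" "is_zeta_sequence A \<zeta>'"
  shows "\<zeta> = \<zeta>'"
  using assms(2,3) unfolding is_zeta_sequence_def
  by (intro proper_riordan_coeffs_unique [OF assms(1)]) metis

lemma alpha_sequence_unique:
  assumes "proper_riordan A" "is_alpha_sequence A \<alpha>" "is_alpha_sequence A \<alpha>'"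
  shows "\<alpha> = \<alpha>'"
proof (rule proper_riordan_coeffs_unique [OF assms(1)])
  fix n
  have "A (n + 1) (0 + 1) = Sum_any (\<lambda>j. \<alpha> j * A n (0 + j))"
    "A (n + 1) (0 + 1) = Sum_any (\<lambda>j. \<alpha>' j * A n (0 + j))"
    using assms(2,3) unfolding is_alpha_sequence_def by blast+
  then show "Sum_any (\<lambda>j. \<alpha> j * A n j) = Sum_any (\<lambda>j. \<alpha>' j * A n j)"
    by simp
qed

end

theory Submission
  imports Defs
begin

text \<open>The rows of the ECO matrix \<open>A\<close> of \<open>P\<close> satisfy the single recurrence \<open>row\<^sub>n\<^sub>+\<^sub>1 = row\<^sub>n P\<close>, so
  column \<open>k\<close> of \<open>P\<close> lists the coefficients with which each entry in column \<open>k\<close> of \<open>A\<close>, below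
  row \<open>0\<close>, is written in terms of the preceding row. The \<open>\<zeta>\<close>- and \<open>\<alpha>\<close>-sequences are
  coefficients for exactly the same task, and the displayed shape of \<open>P\<close> says that its column \<open>0\<close>
  is \<open>\<zeta>\<close> and its column \<open>k + 1\<close> is \<open>\<alpha>\<close> moved down by \<open>k\<close> places. Two facts turn this into the equivalence.

  If \<open>A\<close> is a proper Riordan matrix with pair \<open>(d, h)\<close>, then the combination of its columns
  \<open>k, k + 1, \<dots>\<close> with coefficients \<open>c\<close> has the generating function \<open>d (z h)\<^sup>k c(z h)\<close>. Hence \<open>\<zeta>\<close> and \<open>\<alpha>\<close> only need to
  solve \<open>d = d(0) + z d \<zeta>(z h)\<close> and \<open>h = \<alpha>(z h)\<close>, which is possible because \<open>z h\<close> has a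
  compositional inverse (see \<open>riordan_zeta_alphaI\<close> and \<open>proper_riordan_zeta_alpha_exist\<close>).
  As \<open>A\<close> is lower triangular with nonzero diagonal, the coefficients in row recurrences are unique,
  so the columns of \<open>P\<close> are the ones prescribed by \<open>\<zeta>\<close> and \<open>\<alpha>\<close>.

  Conversely, given \<open>\<zeta>\<close> and \<open>\<alpha>\<close> with \<open>\<alpha>\<^sub>0 \<noteq> 0\<close>, the same two equations can be solved for \<open>d\<close>
  and \<open>h\<close> with \<open>d(0) = 1\<close> (Lagrange inversion for \<open>h\<close>), which gives a proper Riordan matrix with
  first row \<open>(1, 0, 0, \<dots>)\<close> (see \<open>proper_riordan_with_zeta_alpha\<close>). It obeys the same row
  recurrence and has the same first row as \<open>A\<close>, so it is \<open>A\<close>.\<close>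

section \<open>Row recurrences of Riordan matrices\<close>

text \<open>This is the step known as the fundamental theorem of Riordan matrices, applied to the
  coefficients \<open>c\<close> moved down by \<open>k\<close> places: summing \<open>c\<^sub>j d (z h)\<^sup>k\<^sup>+\<^sup>j\<close> over \<open>j\<close> factors
  \<open>d (z h)\<^sup>k\<close> out of the substitution \<open>c(z h)\<close>.\<close>

lemma riordan_column_combination:
  assumes R: "riordan_with d h A"
  shows "Sum_any (\<lambda>j. c j * A n (k + j)) =
         fps_nth (d * (fps_X * h) ^ k * (Abs_fps c oo (fps_X * h))) n"
proof -
  let ?g = "fps_X * h" and ?D = "d * (fps_X * h) ^ k"
  have col: "A n (k + j) = fps_nth (?D * ?g ^ j) n" for j
  proof -
    have "A n (k + j) = fps_nth (Abs_fps (\<lambda>n. A n (k + j))) n" by simp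
    also have "Abs_fps (\<lambda>n. A n (k + j)) = d * ?g ^ (k + j)"
      using R unfolding riordan_with_def by blast
    finally show ?thesis by (simp add: power_add mult.assoc)
  qed
  have low: "A n (k + j) = 0" if "n < j" for j
    using R that unfolding riordan_with_def by auto
  have g0: "fps_nth ?g 0 = 0" by simp
  have "fps_nth (?D * (Abs_fps c oo ?g)) n =
        (\<Sum>m=0..n. fps_nth ?D (n - m) * (\<Sum>j=0..m. c j * fps_nth (?g ^ j) m))"
    by (subst mult.commute)
       (simp add: fps_mult_nth fps_compose_nth mult.commute)
  also have "\<dots> = (\<Sum>m=0..n. fps_nth ?D (n - m) * (\<Sum>j=0..n. c j * fps_nth (?g ^ j) m))"
  proof (rule sum.cong [OF refl])
    fix m assume m: "m \<in> {0..n}"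
    \<comment> \<open>The terms with \<open>j > m\<close> vanish because \<open>z h\<close> has no constant term.\<close>
    have "(\<Sum>j=0..m. c j * fps_nth (?g ^ j) m) = (\<Sum>j=0..n. c j * fps_nth (?g ^ j) m)"
      by (rule sum.mono_neutral_left)
         (use m startsby_zero_power_prefix [OF g0] in auto)
    then show "fps_nth ?D (n - m) * (\<Sum>j=0..m. c j * fps_nth (?g ^ j) m) =
               fps_nth ?D (n - m) * (\<Sum>j=0..n. c j * fps_nth (?g ^ j) m)"
      by simp
  qed
  also have "\<dots> = (\<Sum>j=0..n. c j * (\<Sum>m=0..n. fps_nth (?g ^ j) m * fps_nth ?D (n - m)))"
    unfolding sum_distrib_left by (subst sum.swap) (simp add: mult_ac)
  also have "\<dots> = (\<Sum>j=0..n. c j * fps_nth (?g ^ j * ?D) n)"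
    by (simp only: fps_mult_nth)
  also have "\<dots> = (\<Sum>j=0..n. c j * A n (k + j))"
    by (simp only: col mult.commute [of ?D])
  also have "\<dots> = Sum_any (\<lambda>j. c j * A n (k + j))"
    by (rule Sum_any.expand_superset [symmetric])
       (use low in \<open>auto simp: not_less [symmetric]\<close>)
  finally show ?thesis by simp
qed

text \<open>Moving a column up by one row removes its constant term and divides by \<open>z\<close>; the two
  equations say that this division produces the combinations of columns demanded by the
  recurrences.\<close>

lemma riordan_zeta_alphaI:
  assumes R: "riordan_with d h A" and h0: "fps_nth h 0 \<noteq> 0"
    and d_eq: "d = fps_const (fps_nth d 0) + fps_X * (d * (Abs_fps \<zeta> oo (fps_X * h)))"
    and h_eq: "h = Abs_fps \<alpha> oo (fps_X * h)"
  shows "is_zeta_sequence A \<zeta>" "is_alpha_sequence A \<alpha>"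
proof -
  let ?g = "fps_X * h"
  have col: "A n k = fps_nth (d * ?g ^ k) n" for n k
  proof -
    have "A n k = fps_nth (Abs_fps (\<lambda>n. A n k)) n" by simp
    also have "Abs_fps (\<lambda>n. A n k) = d * ?g ^ k"
      using R unfolding riordan_with_def by blast
    finally show ?thesis .
  qed
  show "is_zeta_sequence A \<zeta>"
    unfolding is_zeta_sequence_def
  proof
    fix n
    have "A (n + 1) 0 = fps_nth d (Suc n)" by (simp add: col)
    also have "\<dots> = fps_nth (d * (Abs_fps \<zeta> oo ?g)) n"
      by (subst d_eq) simp
    also have "\<dots> = Sum_any (\<lambda>j. \<zeta> j * A n j)"
      using riordan_column_combination [OF R, of \<zeta> n 0] by simp
    finally show "A (n + 1) 0 = Sum_any (\<lambda>j. \<zeta> j * A n j)" .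
  qed
  show "is_alpha_sequence A \<alpha>"
    unfolding is_alpha_sequence_def
  proof (intro conjI allI)
    have "fps_nth h 0 = \<alpha> 0" by (subst h_eq) simp
    with h0 show "\<alpha> 0 \<noteq> 0" by simp
    fix n k
    have "d * ?g ^ (k + 1) = fps_X * (d * ?g ^ k * h)" by (simp add: mult_ac)
    then have "A (n + 1) (k + 1) = fps_nth (fps_X * (d * ?g ^ k * h)) (n + 1)"
      by (simp only: col)
    also have "\<dots> = fps_nth (d * ?g ^ k * h) n" by simp
    also have "\<dots> = fps_nth (d * ?g ^ k * (Abs_fps \<alpha> oo ?g)) n"
      by (subst h_eq [symmetric]) simp
    finally show "A (n + 1) (k + 1) = Sum_any (\<lambda>j. \<alpha> j * A n (k + j))"
      by (simp add: riordan_column_combination [OF R])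
  qed
qed

text \<open>A series \<open>z h\<close> with \<open>h(0) \<noteq> 0\<close> is invertible for substitution, so every series is a series
  in \<open>z h\<close>.\<close>

lemma fps_compose_delta_surj:
  fixes h f :: "'a::field fps"
  assumes "fps_nth h 0 \<noteq> 0"
  obtains c where "Abs_fps c oo (fps_X * h) = f"
proof
  let ?g = "fps_X * h"
  have g: "fps_nth ?g 0 = 0" "fps_nth ?g 1 \<noteq> 0" using assms by simp_all
  have "(f oo fps_inv ?g) oo ?g = f oo (fps_inv ?g oo ?g)"
    by (rule fps_compose_assoc [symmetric]) (use g in \<open>simp_all add: fps_inv_def\<close>)
  also have "\<dots> = f" using fps_inv [OF g] by simp
  finally show "Abs_fps (fps_nth (f oo fps_inv ?g)) oo ?g = f" by (simp add: fps_nth_inverse)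
qed

lemma proper_riordan_zeta_alpha_exist:
  assumes "proper_riordan A"
  obtains \<zeta> \<alpha> where "is_zeta_sequence A \<zeta>" "is_alpha_sequence A \<alpha>"
proof -
  obtain d h where R: "riordan_with d h A" and h0: "fps_nth h 0 \<noteq> 0"
    using assms unfolding proper_riordan_def by blast
  have d0: "fps_nth d 0 \<noteq> 0" using R unfolding riordan_with_def by blast
  obtain \<alpha> where \<alpha>: "Abs_fps \<alpha> oo (fps_X * h) = h"
    using fps_compose_delta_surj [OF h0] .
  obtain \<zeta> where \<zeta>: "Abs_fps \<zeta> oo (fps_X * h) = fps_shift 1 d * inverse d"
    using fps_compose_delta_surj [OF h0] .
  have "d * (fps_shift 1 d * inverse d) = fps_shift 1 d * (inverse d * d)"
    by (simp add: mult_ac)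
  also have "\<dots> = fps_shift 1 d" by (simp only: inverse_mult_eq_1 [OF d0] mult_1_right)
  finally have "d * (Abs_fps \<zeta> oo (fps_X * h)) = fps_shift 1 d" by (simp only: \<zeta>)
  then have "d = fps_const (fps_nth d 0) + fps_X * (d * (Abs_fps \<zeta> oo (fps_X * h)))"
    by (intro fps_ext) simp
  from riordan_zeta_alphaI [OF R h0 this \<alpha> [symmetric]] that show ?thesis by blast
qed

text \<open>The equation \<open>h = \<alpha>(z h)\<close> says that \<open>g = z h\<close> satisfies \<open>g / \<alpha>(g) = z\<close>, so \<open>g\<close> is the
  compositional inverse of \<open>z / \<alpha>(z)\<close>. The equation for \<open>d\<close> is linear once \<open>h\<close> is known.\<close>

lemma proper_riordan_with_zeta_alpha:
  fixes \<zeta> \<alpha> :: "nat \<Rightarrow> 'a::field"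
  assumes a0: "\<alpha> 0 \<noteq> 0"
  obtains B where "proper_riordan B" "B 0 = (\<lambda>k. if k = 0 then 1 else 0)"
    "is_zeta_sequence B \<zeta>" "is_alpha_sequence B \<alpha>"
proof -
  define F where "F = Abs_fps \<alpha>"
  define w where "w = fps_X * inverse F"
  define g where "g = fps_inv w"
  define h where "h = F oo g"
  have F0: "fps_nth F 0 \<noteq> 0" using a0 by (simp add: F_def)
  have w: "fps_nth w 0 = 0" "fps_nth w 1 \<noteq> 0" using F0 by (simp_all add: w_def)
  have g0: "fps_nth g 0 = 0" by (simp add: g_def fps_inv_def)
  have h0: "fps_nth h 0 \<noteq> 0" using F0 by (simp add: h_def)
  have "fps_X = w oo g" unfolding g_def using fps_inv_right [OF w] by simp
  also have "\<dots> = g * inverse h"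
    unfolding w_def h_def using g0 F0
    by (simp add: fps_compose_mult_distrib fps_inverse_compose)
  finally have "fps_X * h = g * (inverse h * h)" by (simp add: mult.assoc)
  then have gh: "fps_X * h = g" by (simp only: inverse_mult_eq_1 [OF h0] mult_1_right)
  define e where "e = 1 - fps_X * (Abs_fps \<zeta> oo g)"
  define d where "d = inverse e"
  have "fps_nth e 0 \<noteq> 0" by (simp add: e_def)
  then have de: "d * e = 1" unfolding d_def by (rule inverse_mult_eq_1)
  have d0: "fps_nth d 0 = 1" by (simp add: d_def e_def)
  have d_eq: "d = fps_const (fps_nth d 0) + fps_X * (d * (Abs_fps \<zeta> oo (fps_X * h)))"
    using de unfolding e_def d0 gh by (simp add: algebra_simps)
  have h_eq: "h = Abs_fps \<alpha> oo (fps_X * h)" unfolding gh by (simp add: h_def F_def)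
  define B where "B = (\<lambda>n k. fps_nth (d * (fps_X * h) ^ k) n)"
  have "B n k = 0" if "n < k" for n k
  proof -
    have "d * (fps_X * h) ^ k = fps_X ^ k * (d * h ^ k)"
      by (simp add: power_mult_distrib mult_ac)
    then have "B n k = fps_nth (fps_X ^ k * (d * h ^ k)) n" by (simp only: B_def)
    then show ?thesis using that by (simp add: fps_X_power_mult_nth)
  qed
  then have R: "riordan_with d h B"
    using d0 by (auto simp: riordan_with_def B_def fps_eq_iff)
  have "proper_riordan B" using R h0 unfolding proper_riordan_def by blast
  moreover have "B 0 = (\<lambda>k. if k = 0 then 1 else 0)"
    by (auto simp: B_def d0 fps_nth_power_0)
  ultimately show ?thesis
    using that riordan_zeta_alphaI [OF R h0 d_eq h_eq] by blast
qed

lemma zeta_alpha_row0_determine: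
  assumes "is_zeta_sequence A \<zeta>" "is_alpha_sequence A \<alpha>"
    and "is_zeta_sequence B \<zeta>" "is_alpha_sequence B \<alpha>" and "A 0 = B 0"
  shows "A = B"
proof
  fix n
  show "A n = B n"
  proof (induction n)
    case 0
    show ?case by fact
  next
    case (Suc n)
    show ?case
    proof
      fix k
      show "A (Suc n) k = B (Suc n) k"
        by (cases k) (use assms(1-4) Suc in \<open>simp_all add: is_zeta_sequence_def is_alpha_sequence_def\<close>)
    qed
  qed
qed

section \<open>The row recurrence of an ECO matrix\<close>

lemma eco_matrix_eq_mat_pow: "eco_matrix P n k = mat_pow P n 0 k"
proof -
  have "eco_matrix P n k = (\<Sum>i\<in>{0}. unit_vec0 i * mat_pow P n i k)"
    unfolding eco_matrix_def
    by (rule Sum_any.expand_superset) (auto simp: unit_vec0_def split: if_splits)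
  then show ?thesis by (simp add: unit_vec0_def)
qed

lemma eco_matrix_0: "eco_matrix P 0 k = (if k = 0 then 1 else 0)"
  by (simp add: eco_matrix_eq_mat_pow)

lemma eco_matrix_Suc: "eco_matrix P (Suc n) k = Sum_any (\<lambda>j. eco_matrix P n j * P j k)"
  by (simp add: eco_matrix_eq_mat_pow mat_mult_def)

lemma finite_eco_matrix_row:
  assumes "production_matrix P"
  shows "finite {k. eco_matrix P n k \<noteq> 0}"
proof (induction n)
  case 0
  show ?case by (simp add: eco_matrix_0)
next
  case (Suc n)
  have "{k. eco_matrix P (Suc n) k \<noteq> 0} \<subseteq>
        (\<Union>j\<in>{j. eco_matrix P n j \<noteq> 0}. {k. P j k \<noteq> 0})"
  proof
    fix k assume "k \<in> {k. eco_matrix P (Suc n) k \<noteq> 0}"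
    then have "Sum_any (\<lambda>j. eco_matrix P n j * P j k) \<noteq> 0" by (simp add: eco_matrix_Suc)
    then obtain j where "eco_matrix P n j * P j k \<noteq> 0"
      by (rule Sum_any.not_neutral_obtains_not_neutral)
    then show "k \<in> (\<Union>j\<in>{j. eco_matrix P n j \<noteq> 0}. {k. P j k \<noteq> 0})" by auto
  qed
  then show ?case
    by (rule finite_subset) (use Suc assms in \<open>auto simp: production_matrix_def\<close>)
qed

text \<open>Row finiteness makes the sum range over a fixed finite set, through which \<^const>\<open>of_nat\<close> can be
  pulled; in positive characteristic it may shrink the support, which then only drops zeros.\<close>

lemma of_nat_eco_matrix_Suc:
  assumes "production_matrix P"
  shows "(of_nat (eco_matrix P (Suc n) k) :: 'a::comm_semiring_1) =
         Sum_any (\<lambda>j. of_nat (P j k) * of_nat (eco_matrix P n j))"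
proof -
  let ?S = "{j. eco_matrix P n j \<noteq> 0}"
  note fin = finite_eco_matrix_row [OF assms, of n]
  have "eco_matrix P (Suc n) k = (\<Sum>j\<in>?S. eco_matrix P n j * P j k)"
    unfolding eco_matrix_Suc by (rule Sum_any.expand_superset [OF fin]) auto
  then have "(of_nat (eco_matrix P (Suc n) k) :: 'a) =
             (\<Sum>j\<in>?S. of_nat (P j k) * of_nat (eco_matrix P n j))"
    by (simp add: mult.commute)
  also have "\<dots> = Sum_any (\<lambda>j. of_nat (P j k) * of_nat (eco_matrix P n j))"
    by (rule Sum_any.expand_superset [symmetric, OF fin]) (auto intro: ccontr)
  finally show ?thesis .
qed

section \<open>Comparing the two recurrences\<close>

text \<open>Column \<open>k + 1\<close> of a matrix of the displayed shape is \<open>\<alpha>\<close> moved down by \<open>k\<close> places, whereas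
  the defining recurrence of an \<open>\<alpha>\<close>-sequence moves the row instead.\<close>

lemma Sum_any_shift_coefficients:
  fixes c v :: "nat \<Rightarrow> 'a::semiring_0"
  shows "Sum_any (\<lambda>j. c j * v (k + j)) = Sum_any (\<lambda>j. (if j < k then 0 else c (j - k)) * v j)"
proof -
  let ?S = "{j. c j * v (k + j) \<noteq> 0}"
  let ?T = "{j. (if j < k then 0 else c (j - k)) * v j \<noteq> 0}"
  have "bij_betw (\<lambda>j. k + j) ?S ?T"
    by (rule bij_betw_byWitness [where f' = "\<lambda>j. j - k"]) (auto split: if_splits)
  then have "(\<Sum>j\<in>?S. (\<lambda>j. (if j < k then 0 else c (j - k)) * v j) (k + j)) =
             (\<Sum>j\<in>?T. (if j < k then 0 else c (j - k)) * v j)"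
    by (rule sum.reindex_bij_betw)
  then show ?thesis by (simp add: Sum_any.expand_set)
qed

lemma zeta_alpha_form_imp_sequences:
  fixes A :: "nat \<Rightarrow> nat \<Rightarrow> 'a::field_char_0"
  assumes P: "production_matrix P" and A: "A = (\<lambda>n k. of_nat (eco_matrix P n k))"
    and form: "zeta_alpha_form \<zeta> \<alpha> P" and a0: "\<alpha> 0 \<noteq> 0"
  shows "is_zeta_sequence A (\<lambda>i. of_nat (\<zeta> i))" "is_alpha_sequence A (\<lambda>i. of_nat (\<alpha> i))"
proof -
  have P0: "P i 0 = \<zeta> i" for i using form by (simp add: zeta_alpha_form_def)
  have PS: "P i (Suc k) = (if i < k then 0 else \<alpha> (i - k))" for i k
    using form by (simp add: zeta_alpha_form_def)
  show "is_zeta_sequence A (\<lambda>i. of_nat (\<zeta> i))"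
    by (simp add: is_zeta_sequence_def A of_nat_eco_matrix_Suc [OF P] P0)
  have "A (Suc n) (Suc k) = Sum_any (\<lambda>j. of_nat (\<alpha> j) * A n (k + j))" for n k
  proof -
    have "A (Suc n) (Suc k) = Sum_any (\<lambda>j. of_nat (P j (Suc k)) * A n j)"
      by (simp add: A of_nat_eco_matrix_Suc [OF P])
    also have "(\<lambda>j. of_nat (P j (Suc k)) * A n j) =
               (\<lambda>j. (if j < k then 0 else of_nat (\<alpha> (j - k))) * A n j)"
      by (simp add: fun_eq_iff PS)
    finally show ?thesis
      by (simp only: Sum_any_shift_coefficients [of "\<lambda>j. of_nat (\<alpha> j)" "A n" k])
  qed
  then show "is_alpha_sequence A (\<lambda>i. of_nat (\<alpha> i))"
    using a0 by (simp add: is_alpha_sequence_def)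
qed

text \<open>A column of \<open>P\<close> and the corresponding shifted sequence are coefficients for the same row
  recurrence, and such coefficients are unique because \<open>A\<close> is triangular with nonzero
  diagonal.\<close>

lemma proper_riordan_production_entries:
  fixes A :: "nat \<Rightarrow> nat \<Rightarrow> 'a::field_char_0"
  assumes P: "production_matrix P" and A: "A = (\<lambda>n k. of_nat (eco_matrix P n k))"
    and R: "proper_riordan A"
    and \<zeta>: "is_zeta_sequence A \<zeta>" and \<alpha>: "is_alpha_sequence A \<alpha>"
  shows "of_nat (P i 0) = \<zeta> i"
    and "of_nat (P i (Suc k)) = (if i < k then 0 else \<alpha> (i - k))"
proof -
  have step: "A (Suc n) k = Sum_any (\<lambda>j. of_nat (P j k) * A n j)" for n k
    by (simp add: A of_nat_eco_matrix_Suc [OF P])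
  have "(\<lambda>i. of_nat (P i 0)) = \<zeta>"
    by (rule proper_riordan_coeffs_unique [OF R])
       (use \<zeta> in \<open>simp add: is_zeta_sequence_def step\<close>)
  then show "of_nat (P i 0) = \<zeta> i" by (rule fun_cong)
  have "(\<lambda>i. of_nat (P i (Suc k))) = (\<lambda>i. if i < k then 0 else \<alpha> (i - k))"
  proof (rule proper_riordan_coeffs_unique [OF R])
    fix n
    have "Sum_any (\<lambda>j. of_nat (P j (Suc k)) * A n j) = A (n + 1) (k + 1)"
      by (simp add: step)
    also have "\<dots> = Sum_any (\<lambda>j. \<alpha> j * A n (k + j))"
      using \<alpha> unfolding is_alpha_sequence_def by blast
    also have "\<dots> = Sum_any (\<lambda>j. (if j < k then 0 else \<alpha> (j - k)) * A n j)"
      by (rule Sum_any_shift_coefficients)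
    finally show "Sum_any (\<lambda>j. of_nat (P j (Suc k)) * A n j) =
                  Sum_any (\<lambda>j. (if j < k then 0 else \<alpha> (j - k)) * A n j)" .
  qed
  then show "of_nat (P i (Suc k)) = (if i < k then 0 else \<alpha> (i - k))" by (rule fun_cong)
qed

theorem proposition3p1:
  fixes P :: "nat \<Rightarrow> nat \<Rightarrow> nat"
    and A :: "nat \<Rightarrow> nat \<Rightarrow> 'a::field_char_0"
  assumes "production_matrix P"
    and "A = (\<lambda>n k. of_nat (eco_matrix P n k))"
  shows "(proper_riordan A \<longleftrightarrow> (\<exists>\<zeta> \<alpha>. \<alpha> 0 \<noteq> 0 \<and> zeta_alpha_form \<zeta> \<alpha> P)) \<and>
         (proper_riordan A \<longrightarrow>
            is_zeta_sequence A (\<lambda>i. of_nat (P i 0)) \<and>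
            is_alpha_sequence A (\<lambda>i. of_nat (P i 1)))"
proof -
  have forward: "P 0 1 \<noteq> 0 \<and> zeta_alpha_form (\<lambda>i. P i 0) (\<lambda>i. P i 1) P \<and>
      is_zeta_sequence A (\<lambda>i. of_nat (P i 0)) \<and> is_alpha_sequence A (\<lambda>i. of_nat (P i 1))"
    if R: "proper_riordan A"
  proof -
    obtain \<zeta> \<alpha> where \<zeta>: "is_zeta_sequence A \<zeta>" and \<alpha>: "is_alpha_sequence A \<alpha>"
      using proper_riordan_zeta_alpha_exist [OF R] .
    note entries = proper_riordan_production_entries [OF assms R \<zeta> \<alpha>]
    have z: "(\<lambda>i. of_nat (P i 0)) = \<zeta>" using entries(1) by (rule ext)
    have a: "of_nat (P i 1) = \<alpha> i" for i using entries(2) [of i 0] by simp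
    then have a': "(\<lambda>i. of_nat (P i 1)) = \<alpha>" by (rule ext)
    have PS: "P i (Suc k) = (if i < k then 0 else P (i - k) 1)" for i k
    proof -
      have "(of_nat (P i (Suc k)) :: 'a) = of_nat (if i < k then 0 else P (i - k) 1)"
        using entries(2) [of i k] a [of "i - k"] by (simp split: if_splits del: of_nat_eq_iff)
      then show ?thesis by (simp only: of_nat_eq_iff)
    qed
    have "P i j = P (i + 1 - j) 1" if "1 \<le> j" "j \<le> i + 1" for i j
      using PS [of i "j - 1"] that by (cases j) auto
    moreover have "P i j = 0" if "j > i + 1" for i j
      using PS [of i "j - 1"] that by (cases j) auto
    ultimately have "zeta_alpha_form (\<lambda>i. P i 0) (\<lambda>i. P i 1) P"
      unfolding zeta_alpha_form_def by blast
    moreover have "P 0 1 \<noteq> 0"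
      using \<alpha> a [of 0] unfolding is_alpha_sequence_def by (metis of_nat_0)
    ultimately show ?thesis using \<zeta> \<alpha> unfolding z a' by blast
  qed
  have backward: "proper_riordan A"
    if a0: "\<alpha> 0 \<noteq> 0" and form: "zeta_alpha_form \<zeta> \<alpha> P" for \<zeta> \<alpha>
  proof -
    have "(of_nat (\<alpha> 0) :: 'a) \<noteq> 0" using a0 by simp
    then obtain B where B: "proper_riordan B" "B 0 = (\<lambda>k. if k = 0 then 1 else (0::'a))"
      "is_zeta_sequence B (\<lambda>i. of_nat (\<zeta> i))" "is_alpha_sequence B (\<lambda>i. of_nat (\<alpha> i))"
      by (rule proper_riordan_with_zeta_alpha)
    have "A 0 = B 0" by (auto simp: assms(2) B(2) eco_matrix_0)
    then have "A = B"
      by (rule zeta_alpha_row0_determine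
            [OF zeta_alpha_form_imp_sequences [OF assms form a0] B(3,4)])
    with B(1) show ?thesis by simp
  qed
  show ?thesis
  proof (intro conjI impI iffI)
    assume R: "proper_riordan A"
    show "\<exists>\<zeta> \<alpha>. \<alpha> 0 \<noteq> 0 \<and> zeta_alpha_form \<zeta> \<alpha> P"
      by (rule exI [of _ "\<lambda>i. P i 0"], rule exI [of _ "\<lambda>i. P i 1"]) (use forward [OF R] in simp)
  next
    assume "\<exists>\<zeta> \<alpha>. \<alpha> 0 \<noteq> 0 \<and> zeta_alpha_form \<zeta> \<alpha> P"
    then show "proper_riordan A" by (elim exE conjE) (rule backward)
  qed (use forward in simp_all)
qed

end
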